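(* For every $n\ge 1$ there is a constant $c_n>0$ depending only on $n$ such that, for every weight $w$ in $\mathbb{R}^n$ with $w\notin L^1(\mathbb{R}^n)$, every $\frac12\le\delta<1$ and every bounded measurable set $E\subset\mathbb{R}^n$, $$w(E)^{\frac{n-\delta}{n}}\le c_n\,(1-\delta)\left(\int_E\int_{\mathbb{R}^n\setminus E}\frac{1}{|x-y|^{n+\delta}}\,dy\,\big(Mw(x)\big)^{\frac{n-\delta}{n}}\,dx+\int_{\mathbb{R}^n\setminus E}\int_E\frac{1}{|x-y|^{n+\delta}}\,dy\,\big(Mw(x)\big)^{\frac{n-\delta}{n}}\,dx\right).$$
   Context: A weight is a function $w\in L^1_{\mathrm{loc}}(\mathbb{R}^n)$ with $w(x)>0$ for a.e. $x$; $w(E)=\int_E w\,dx$. $M$ is the non-centered Hardy–Littlewood maximal function $Mf(x)=\sup_{R\ni x}\frac1{|R|}\int_R|f|\,dy$, the supremum over all cubes $R$ (cartesian products of $n$ intervals of the same side length) in $\mathbb{R}^n$ containing $x$. *)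

theory Defs
  imports "HOL-Analysis.Analysis"
begin

definition locally_integrable :: "(real^'n \<Rightarrow> real) \<Rightarrow> bool" where
  "locally_integrable f \<longleftrightarrow> (\<forall>K. compact K \<longrightarrow> set_integrable lebesgue K f)"

definition weight :: "(real^'n \<Rightarrow> real) \<Rightarrow> bool" where
  "weight w \<longleftrightarrow> locally_integrable w \<and> (AE x in lebesgue. w x > 0)"

definition weight_measure :: "(real^'n \<Rightarrow> real) \<Rightarrow> (real^'n) set \<Rightarrow> ennreal" where
  "weight_measure w E = (\<integral>\<^sup>+ x\<in>E. ennreal (w x) \<partial>lebesgue)"

text \<open>The inclusions say that each factor \<open>I i\<close> is an open, closed or half-open interval
  with endpoints \<open>a i\<close> and \<open>a i + l\<close>.\<close>

definition cube :: "(real^'n) set \<Rightarrow> bool" where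
  "cube R \<longleftrightarrow> (\<exists>I a l. l > 0 \<and>
     (\<forall>i. {a i<..<a i + l} \<subseteq> I i \<and> I i \<subseteq> {a i..a i + l}) \<and>
     R = {x. \<forall>i. x $ i \<in> I i})"

definition maximal_function :: "(real^'n \<Rightarrow> real) \<Rightarrow> real^'n \<Rightarrow> ennreal" where
  "maximal_function f x =
     (SUP R\<in>{R. cube R \<and> x \<in> R}.
        (\<integral>\<^sup>+ y\<in>R. ennreal \<bar>f y\<bar> \<partial>lebesgue) / emeasure lebesgue R)"

text \<open>Powers with exponent \<open>p > 0\<close> on \<open>[0, \<infinity>]\<close>, where \<open>\<infinity>\<close> to the power \<open>p\<close> is \<open>\<infinity>\<close>;
  needed because \<^const>\<open>maximal_function\<close> may be infinite.\<close>

definition ennreal_powr :: "ennreal \<Rightarrow> real \<Rightarrow> ennreal" where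
  "ennreal_powr x p = (if x = \<infinity> then \<infinity> else ennreal (enn2real x powr p))"

end

theory Submission
  imports Defs
begin

text \<open>
  Almost all of \<open>E\<close> is covered by disjoint dyadic cubes \<open>Q\<close> in which both \<open>E\<close> and its complement
  occupy a fixed fraction of the volume (\<open>half_dense_dyadic_decomposition\<close>): take the maximal dyadic
  cubes in which \<open>E\<close> has density at least \<open>2 ^ -(n+1)\<close>. Maximal ones exist because \<open>E\<close> has finite
  volume. The parent of a maximal cube has density below \<open>2 ^ -(n+1)\<close>, and passing from the parent to
  one of its \<open>2 ^ n\<close> children increases the density at most by the factor \<open>2 ^ n\<close>, so the density in
  the cube itself is at most \<open>1/2\<close>.

  On such a cube of side \<open>l\<close> there is a relative isoperimetric inequality with the sharp factor
  (\<open>half_dense_cube_estimate\<close>):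
  \<open>l powr (n - \<delta>)\<close> is at most \<open>c (1 - \<delta>)\<close> times the interaction of \<open>E \<inter> Q\<close> with \<open>-E\<close>.
  The interaction of \<open>A\<close> with \<open>B\<close> is the integral of \<open>|h| powr -(n + \<delta>) * \<phi> h\<close>, where
  \<open>\<phi> h\<close> is the volume of the \<open>x \<in> A\<close> with \<open>x + h \<in> B\<close>. If \<open>A \<union> B\<close> is convex then a
  step \<open>2 h\<close> from \<open>A\<close> to \<open>B\<close> passes over a midpoint in \<open>A\<close> or in \<open>B\<close>, so that
  \<open>\<phi> (2 h) \<le> 2 \<phi> h\<close>. Contracting \<open>h\<close> by \<open>2 ^ m\<close> therefore shows that the part of the
  integral over the ball of radius \<open>R / 2 ^ m\<close>, where \<open>R\<close> bounds the diameter, is at least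
  \<open>2 powr -(m (1 - \<delta>))\<close> times the whole integral \<open>J\<close>. The remaining part is thus at most
  \<open>(1 - 2 powr -(m (1 - \<delta>))) J \<le> m (1 - \<delta>) J\<close>, while it is bounded below by \<open>R powr -(n + \<delta>)\<close> times
  \<open>|A| (|B| - (2 R / 2 ^ m) ^ n)\<close>, since \<open>\<phi>\<close> is at most \<open>|A|\<close> and has integral \<open>|A| |B|\<close>.

  The weight enters through \<open>w(E \<inter> Q) \<le> l ^ n * Mw(x)\<close> for every \<open>x \<in> Q\<close>. Raising this to
  the power \<open>\<theta> = (n - \<delta>) / n\<close> turns \<open>l ^ n\<close> into \<open>l powr (n - \<delta>)\<close>, to which the estimate on
  cubes applies; the cubes can be summed because \<open>t \<mapsto> t powr \<theta>\<close> is countably subadditive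
  (\<open>powr_sum_le_sum_powr\<close>) and the cubes are disjoint.
\<close>

section \<open>Displacements between two sets\<close>

text \<open>The volume of \<open>A \<inter> (B - h)\<close>, written as an integral so that measurability in \<open>h\<close> is immediate.\<close>

definition crossing :: "'a::euclidean_space set \<Rightarrow> 'a set \<Rightarrow> 'a \<Rightarrow> ennreal" where
  "crossing A B h = (\<integral>\<^sup>+ x. indicator A x * indicator B (x + h) \<partial>lborel)"

lemma crossing_measurable [measurable]:
  assumes [measurable]: "A \<in> sets borel" "B \<in> sets borel"
  shows "crossing A B \<in> borel_measurable borel"
  unfolding crossing_def by measurable

lemma nn_integral_pairs_eq_crossing:
  fixes A B :: "'a::euclidean_space set"
  assumes [measurable]: "A \<in> sets borel" "B \<in> sets borel" "k \<in> borel_measurable borel"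
  shows "(\<integral>\<^sup>+ x\<in>A. (\<integral>\<^sup>+ y\<in>B. k (y - x) \<partial>lborel) \<partial>lborel) = (\<integral>\<^sup>+ h. k h * crossing A B h \<partial>lborel)"
proof -
  have inner: "(\<integral>\<^sup>+ y\<in>B. k (y - x) \<partial>lborel) = (\<integral>\<^sup>+ h. k h * indicator B (x + h) \<partial>lborel)" for x
  proof -
    have "(\<integral>\<^sup>+ y\<in>B. k (y - x) \<partial>lborel) = (\<integral>\<^sup>+ y. k (y - x) * indicator B y \<partial>distr lborel borel ((+) x))"
      by (simp only: lborel_distr_plus)
    also have "\<dots> = (\<integral>\<^sup>+ h. k h * indicator B (x + h) \<partial>lborel)"
      by (subst nn_integral_distr) auto
    finally show ?thesis .
  qed
  have "(\<integral>\<^sup>+ x\<in>A. (\<integral>\<^sup>+ y\<in>B. k (y - x) \<partial>lborel) \<partial>lborel)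
      = (\<integral>\<^sup>+ x. (\<integral>\<^sup>+ h. k h * (indicator A x * indicator B (x + h)) \<partial>lborel) \<partial>lborel)"
    unfolding inner by (subst nn_integral_multc[symmetric]) (auto simp: mult_ac)
  also have "\<dots> = (\<integral>\<^sup>+ h. (\<integral>\<^sup>+ x. k h * (indicator A x * indicator B (x + h)) \<partial>lborel) \<partial>lborel)"
    by (rule lborel_pair.Fubini') measurable
  also have "\<dots> = (\<integral>\<^sup>+ h. k h * crossing A B h \<partial>lborel)"
    unfolding crossing_def by (subst nn_integral_cmult) auto
  finally show ?thesis .
qed

lemma nn_integral_crossing:
  fixes A B :: "'a::euclidean_space set"
  assumes [measurable]: "A \<in> sets borel" "B \<in> sets borel"
  shows "(\<integral>\<^sup>+ h. crossing A B h \<partial>lborel) = emeasure lborel A * emeasure lborel B"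
  using nn_integral_pairs_eq_crossing[of A B "\<lambda>_. 1"]
  by (simp add: nn_integral_multc mult.commute[of "emeasure lborel B"])

lemma crossing_le:
  assumes [measurable]: "A \<in> sets borel"
  shows "crossing A B h \<le> emeasure lborel A"
proof -
  have "crossing A B h \<le> (\<integral>\<^sup>+ x. indicator A x \<partial>lborel)"
    unfolding crossing_def by (rule nn_integral_mono) (auto split: split_indicator)
  then show ?thesis by simp
qed

lemma crossing_eq_0:
  assumes "\<And>x y. x \<in> A \<Longrightarrow> y \<in> B \<Longrightarrow> norm (y - x) \<le> R" "R < norm h"
  shows "crossing A B h = 0"
proof -
  have "indicator A x * indicator B (x + h) = (0::ennreal)" for x
    using assms(1)[of x "x + h"] assms(2) by (auto split: split_indicator)
  then show ?thesis unfolding crossing_def by (simp only: nn_integral_const mult_zero_left)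
qed

text \<open>A step \<open>2 h\<close> that starts in \<open>A\<close> and ends in \<open>B\<close> has its midpoint in the convex set
  \<open>A \<union> B\<close>, so one of its two halves already crosses from \<open>A\<close> to \<open>B\<close>.\<close>

lemma crossing_double:
  fixes A B :: "'a::euclidean_space set"
  assumes [measurable]: "A \<in> sets borel" "B \<in> sets borel" and conv: "convex (A \<union> B)"
  shows "crossing A B (2 *\<^sub>R h) \<le> 2 * crossing A B h"
proof -
  have mid: "x + h \<in> A \<union> B" if "x \<in> A" "x + 2 *\<^sub>R h \<in> B" for x
  proof -
    have "(1/2) *\<^sub>R x + (1/2) *\<^sub>R (x + 2 *\<^sub>R h) \<in> A \<union> B"
      using that by (intro convexD[OF conv]) auto
    moreover have "(1/2) *\<^sub>R x + (1/2) *\<^sub>R (x + 2 *\<^sub>R h) = x + h"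
      by (simp add: scaleR_add_right flip: scaleR_add_left)
    ultimately show ?thesis by simp
  qed
  have "crossing A B (2 *\<^sub>R h)
      \<le> (\<integral>\<^sup>+ x. indicator A x * indicator B (x + h)
            + indicator A (x + h) * indicator B (x + 2 *\<^sub>R h) \<partial>lborel)"
    unfolding crossing_def
    by (rule nn_integral_mono) (use mid in \<open>auto split: split_indicator\<close>)
  also have "\<dots> = crossing A B h + (\<integral>\<^sup>+ x. indicator A (x + h) * indicator B (x + 2 *\<^sub>R h) \<partial>lborel)"
    unfolding crossing_def by (subst nn_integral_add) auto
  also have "(\<integral>\<^sup>+ x. indicator A (x + h) * indicator B (x + 2 *\<^sub>R h) \<partial>lborel)
      = (\<integral>\<^sup>+ y. indicator A y * indicator B (y + h) \<partial>distr lborel borel ((+) h))"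
    by (subst nn_integral_distr) (auto simp: add_ac scaleR_2)
  also have "\<dots> = crossing A B h"
    unfolding crossing_def by (simp only: lborel_distr_plus)
  finally show ?thesis by (simp add: mult_2)
qed

lemma crossing_power_of_2:
  fixes A B :: "'a::euclidean_space set"
  assumes "A \<in> sets borel" "B \<in> sets borel" "convex (A \<union> B)"
  shows "crossing A B ((2 ^ m) *\<^sub>R h) \<le> 2 ^ m * crossing A B h"
proof (induction m)
  case (Suc m)
  have "crossing A B ((2 ^ Suc m) *\<^sub>R h) \<le> 2 * crossing A B ((2 ^ m) *\<^sub>R h)"
    using crossing_double[OF assms, of "(2 ^ m) *\<^sub>R h"] by simp
  also have "\<dots> \<le> 2 * (2 ^ m * crossing A B h)"
    using Suc by (intro mult_left_mono) auto
  finally show ?case by (simp add: mult_ac)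
qed simp

lemma nn_integral_lborel_scale:
  fixes f :: "'a::euclidean_space \<Rightarrow> ennreal"
  assumes [measurable]: "f \<in> borel_measurable borel" and c: "c > 0"
  shows "(\<integral>\<^sup>+ x. f x \<partial>lborel) = ennreal (c ^ DIM('a)) * (\<integral>\<^sup>+ x. f (c *\<^sub>R x) \<partial>lborel)"
proof -
  have "(\<integral>\<^sup>+ x. f x \<partial>lborel)
      = (\<integral>\<^sup>+ x. f x \<partial>density (distr lborel borel (\<lambda>x. 0 + c *\<^sub>R x)) (\<lambda>_. ennreal (\<bar>c\<bar> ^ DIM('a))))"
    using c by (subst lborel_affine[of c 0]) auto
  also have "\<dots> = ennreal (c ^ DIM('a)) * (\<integral>\<^sup>+ x. f (c *\<^sub>R x) \<partial>lborel)"
    using c by (subst nn_integral_density) (auto simp: nn_integral_distr nn_integral_cmult)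
  finally show ?thesis .
qed

lemma emeasure_lborel_cball_le:
  assumes "r \<ge> 0"
  shows "emeasure lborel (cball (0::'a::euclidean_space) r) \<le> ennreal ((2 * r) ^ DIM('a))"
proof -
  have "cball (0::'a) r \<subseteq> cbox (- r *\<^sub>R One) (r *\<^sub>R One)"
  proof
    fix x :: 'a assume "x \<in> cball 0 r"
    then have "\<bar>x \<bullet> i\<bar> \<le> r" if "i \<in> Basis" for i
      using Basis_le_norm[OF that, of x] by simp
    then show "x \<in> cbox (- r *\<^sub>R One) (r *\<^sub>R One)"
      by (auto simp: mem_box abs_le_iff minus_le_iff)
  qed
  then have "emeasure lborel (cball (0::'a) r) \<le> emeasure lborel (cbox (- r *\<^sub>R One) (r *\<^sub>R One) :: 'a set)"
    by (intro emeasure_mono) auto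
  also have "\<dots> = ennreal ((2 * r) ^ DIM('a))"
  proof -
    have "(\<Prod>b\<in>(Basis::'a set). (r *\<^sub>R One - (- r *\<^sub>R One)) \<bullet> b) = (\<Prod>b\<in>(Basis::'a set). 2 * r)"
      by (rule prod.cong) (simp_all add: inner_add_left)
    then show ?thesis using assms by (subst emeasure_lborel_cbox) simp_all
  qed
  finally show ?thesis .
qed

lemma one_minus_le_powr:
  assumes "0 \<le> (t::real)" shows "1 - t \<le> 2 powr (- t)"
proof -
  have "t * ln 2 \<le> t" using assms ln_2_less_1 by (simp add: mult_left_le)
  moreover have "1 + (- t * ln 2) \<le> exp (- t * ln 2)" by (rule exp_ge_add_one_self)
  ultimately show ?thesis by (simp add: powr_def)
qed

text \<open>The factor \<open>1 - \<delta>\<close> comes from self-similarity. Write \<open>J\<close> for the double integral as an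
  integral over displacements. Its part over short displacements, those of norm at most
  \<open>r = R / 2 ^ m\<close>, is a contracted copy of all of \<open>J\<close> and amounts to at least \<open>q J\<close> with
  \<open>q = 2 powr -(m (1 - \<delta>))\<close>; so the part over long displacements is at most \<open>(1 - q) J\<close>. On the
  other hand, long displacements account for all of the total mass \<open>|A| |B|\<close> of \<open>crossing A B\<close>
  except for at most \<open>|A| (2 r) ^ n\<close>.\<close>

lemma fractional_perimeter_lower_bound:
  fixes A B :: "'a::euclidean_space set" and \<delta> :: real
  assumes AB [measurable]: "A \<in> sets borel" "B \<in> sets borel" and conv: "convex (A \<union> B)"
    and diam: "\<And>x y. x \<in> A \<Longrightarrow> y \<in> B \<Longrightarrow> norm (y - x) \<le> R" and R: "R > 0"
    and a: "emeasure lborel A = ennreal a" "a \<ge> 0" and b: "emeasure lborel B = ennreal b" "b \<ge> 0"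
    and \<delta>: "0 \<le> \<delta>" "\<delta> < 1" and m: "m \<ge> 1"
  shows "ennreal (R powr - (DIM('a) + \<delta>) * (a * (b - (2 * R / 2 ^ m) ^ DIM('a))))
     \<le> ennreal (real m * (1 - \<delta>)) *
        (\<integral>\<^sup>+ x\<in>A. (\<integral>\<^sup>+ y\<in>B. ennreal (1 / norm (x - y) powr (DIM('a) + \<delta>)) \<partial>lborel) \<partial>lborel)"
proof -
  define d where "d = DIM('a)"
  define p where "p = d + \<delta>"
  define s :: real where "s = 2 ^ m"
  define r where "r = R / s"
  define K where "K h = ennreal (1 / norm h powr p)" for h :: 'a
  define \<phi> where "\<phi> = crossing A B"
  define J where "J = (\<integral>\<^sup>+ h. K h * \<phi> h \<partial>lborel)"
  define near where "near = (\<integral>\<^sup>+ h. K h * \<phi> h * indicator (cball 0 r) h \<partial>lborel)"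
  define far where "far = (\<integral>\<^sup>+ h. K h * \<phi> h * indicator (- cball 0 r) h \<partial>lborel)"
  define q where "q = 2 powr (- (real m * (1 - \<delta>)))"
  have [measurable]: "K \<in> borel_measurable borel" unfolding K_def by measurable
  have [measurable]: "\<phi> \<in> borel_measurable borel" unfolding \<phi>_def by measurable
  have [measurable]: "cball 0 r \<in> sets (borel :: 'a measure)" by simp
  have s: "s > 0" by (simp add: s_def)
  have r: "r > 0" using R s by (simp add: r_def)
  have J: "J = (\<integral>\<^sup>+ x\<in>A. (\<integral>\<^sup>+ y\<in>B. ennreal (1 / norm (x - y) powr p) \<partial>lborel) \<partial>lborel)"
    using nn_integral_pairs_eq_crossing[of A B K]
    by (simp add: J_def \<phi>_def K_def norm_minus_commute)
  have split: "J = near + far"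
    unfolding J_def near_def far_def
    by (subst nn_integral_add[symmetric]) (auto intro!: nn_integral_cong split: split_indicator)
  have q: "q = s powr (\<delta> - 1)"
    by (simp add: q_def s_def powr_powr algebra_simps flip: powr_realpow)
  \<comment> \<open>Substituting \<open>h / s\<close> multiplies the kernel by \<open>s powr p\<close>, the volume element by
    \<open>s powr -d\<close> and \<open>\<phi>\<close> at least by \<open>1 / s\<close>: altogether by \<open>s powr (\<delta> - 1) = q\<close>.\<close>
  have near: "ennreal q * J \<le> near"
  proof -
    have "near = ennreal ((1 / s) ^ d) * (\<integral>\<^sup>+ h. K ((1 / s) *\<^sub>R h) * \<phi> ((1 / s) *\<^sub>R h)
        * indicator (cball 0 r) ((1 / s) *\<^sub>R h) \<partial>lborel)"
      unfolding near_def d_def using s by (intro nn_integral_lborel_scale) auto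
    moreover have "(\<integral>\<^sup>+ h. ennreal (s powr (p - 1)) * (K h * \<phi> h) \<partial>lborel) \<le> (\<integral>\<^sup>+ h. K ((1 / s) *\<^sub>R h) * \<phi> ((1 / s) *\<^sub>R h)
        * indicator (cball 0 r) ((1 / s) *\<^sub>R h) \<partial>lborel)"
    proof (rule nn_integral_mono)
      fix h :: 'a
      show "ennreal (s powr (p - 1)) * (K h * \<phi> h) \<le> K ((1 / s) *\<^sub>R h) * \<phi> ((1 / s) *\<^sub>R h)
        * indicator (cball 0 r) ((1 / s) *\<^sub>R h)"
      proof (cases "norm h \<le> R")
        case False
        then have "\<phi> h = 0" unfolding \<phi>_def by (intro crossing_eq_0[OF diam]) auto
        then show ?thesis by simp
      next
        case True
        then have ind: "indicator (cball 0 r) ((1 / s) *\<^sub>R h) = (1::ennreal)"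
          using s by (simp add: r_def divide_right_mono)
        have Ksc: "K ((1 / s) *\<^sub>R h) = ennreal (s powr p) * K h"
          using s by (simp add: K_def powr_divide flip: ennreal_mult)
        have "\<phi> h \<le> 2 ^ m * \<phi> ((1 / s) *\<^sub>R h)"
          using crossing_power_of_2[OF AB conv, of m "(1 / s) *\<^sub>R h"] s
          by (simp add: \<phi>_def s_def)
        also have "2 ^ m = ennreal s"
          by (simp add: s_def flip: ennreal_power)
        finally have \<phi>sc: "\<phi> h \<le> ennreal s * \<phi> ((1 / s) *\<^sub>R h)" .
        have "ennreal (s powr (p - 1)) * (K h * \<phi> h)
            \<le> ennreal (s powr (p - 1)) * (K h * (ennreal s * \<phi> ((1 / s) *\<^sub>R h)))"
          by (intro mult_left_mono \<phi>sc) auto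
        also have "\<dots> = ennreal (s powr (p - 1) * s) * K h * \<phi> ((1 / s) *\<^sub>R h)"
          using s by (simp add: ennreal_mult mult_ac)
        also have "s powr (p - 1) * s = s powr p"
          using s by (simp add: powr_diff)
        finally show ?thesis by (simp add: ind Ksc)
      qed
    qed
    ultimately have "ennreal ((1 / s) ^ d) * (ennreal (s powr (p - 1)) * J) \<le> near"
      by (simp add: nn_integral_cmult J_def mult_left_mono)
    moreover have "(1 / s) ^ d * s powr (p - 1) = q"
    proof -
      have "(1 / s) ^ d = s powr (- real d)"
        using s by (simp add: powr_minus powr_realpow power_one_over divide_inverse power_inverse)
      then show ?thesis using s by (simp add: q p_def flip: powr_add)
    qed
    ultimately show ?thesis
      using s by (simp flip: mult.assoc ennreal_mult)
  qed
  \<comment> \<open>Among the long displacements only those of norm at most \<open>R\<close> matter, and there the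
    kernel is at least \<open>R powr -p\<close>.\<close>
  have far: "ennreal (R powr - p * (a * (b - (2 * r) ^ d))) \<le> far"
  proof -
    define M where "M = (\<integral>\<^sup>+ h. \<phi> h * indicator (- cball 0 r) h \<partial>lborel)"
    have "(\<integral>\<^sup>+ h. \<phi> h * indicator (cball 0 r) h \<partial>lborel) \<le> (\<integral>\<^sup>+ h. ennreal a * indicator (cball (0::'a) r) h \<partial>lborel)"
    proof (rule nn_integral_mono)
      fix h
      have "\<phi> h \<le> ennreal a" using crossing_le[OF AB(1)] a by (simp add: \<phi>_def)
      then show "\<phi> h * indicator (cball 0 r) h \<le> ennreal a * indicator (cball 0 r) h"
        by (rule mult_right_mono) simp
    qed
    also have "\<dots> = ennreal a * emeasure lborel (cball (0::'a) r)"
      by (simp add: nn_integral_cmult_indicator)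
    also have "\<dots> \<le> ennreal a * ennreal ((2 * r) ^ d)"
      using emeasure_lborel_cball_le[of r, where 'a = 'a] r by (intro mult_left_mono) (auto simp: d_def)
    finally have small: "(\<integral>\<^sup>+ h. \<phi> h * indicator (cball 0 r) h \<partial>lborel) \<le> ennreal (a * (2 * r) ^ d)"
      using a r by (simp add: ennreal_mult)
    have "ennreal (a * b) = (\<integral>\<^sup>+ h. \<phi> h \<partial>lborel)"
      using a b by (simp add: \<phi>_def nn_integral_crossing ennreal_mult)
    also have "\<dots> = (\<integral>\<^sup>+ h. \<phi> h * indicator (cball 0 r) h \<partial>lborel) + M"
      unfolding M_def
      by (subst nn_integral_add[symmetric]) (auto intro!: nn_integral_cong split: split_indicator)
    also have "\<dots> \<le> ennreal (a * (2 * r) ^ d) + M"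
      using small by (rule add_right_mono)
    finally have "ennreal (a * b) - ennreal (a * (2 * r) ^ d) \<le> M"
      by (simp add: ennreal_minus_le_iff)
    then have "ennreal (a * (b - (2 * r) ^ d)) \<le> M"
      using a r by (simp add: ennreal_minus algebra_simps)
    then have "ennreal (R powr - p) * ennreal (a * (b - (2 * r) ^ d)) \<le> ennreal (R powr - p) * M"
      by (rule mult_left_mono) simp
    also have "\<dots> = (\<integral>\<^sup>+ h. ennreal (R powr - p) * (\<phi> h * indicator (- cball 0 r) h) \<partial>lborel)"
      unfolding M_def by (subst nn_integral_cmult) auto
    also have "\<dots> \<le> far"
      unfolding far_def
    proof (rule nn_integral_mono)
      fix h :: 'a
      show "ennreal (R powr - p) * (\<phi> h * indicator (- cball 0 r) h) \<le> K h * \<phi> h * indicator (- cball 0 r) h"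
      proof (cases "norm h \<le> R \<and> norm h > r")
        case False
        then show ?thesis
          using crossing_eq_0[of A B R h, OF diam] by (auto simp: \<phi>_def split: split_indicator)
      next
        case True
        then have "norm h powr p \<le> R powr p"
          using \<delta> by (intro powr_mono2) (auto simp: p_def)
        then have "R powr - p \<le> 1 / norm h powr p"
          using True r by (auto simp: powr_minus_divide intro!: divide_left_mono mult_pos_pos)
        then have "ennreal (R powr - p) \<le> K h" unfolding K_def by (rule ennreal_leI)
        then have "ennreal (R powr - p) * (\<phi> h * indicator (- cball 0 r) h) \<le> K h * (\<phi> h * indicator (- cball 0 r) h)"
          by (rule mult_right_mono) simp
        then show ?thesis by (simp add: mult_ac)
      qed
    qed
    finally show ?thesis by (simp only: ennreal_mult'[OF powr_ge_zero])
  qed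
  have t: "real m * (1 - \<delta>) > 0" using m \<delta> by simp
  have q1: "1 - real m * (1 - \<delta>) \<le> q" "0 \<le> q"
    unfolding q_def using one_minus_le_powr[of "real m * (1 - \<delta>)"] t by auto
  have "far \<le> ennreal (real m * (1 - \<delta>)) * J"
  proof (cases J)
    case top
    then show ?thesis using t m \<delta> by (simp add: ennreal_mult_top)
  next
    case (real j)
    have "far \<noteq> \<infinity>" using split real by (auto simp: top_unique)
    then obtain f where f: "far = ennreal f" "f \<ge> 0" by (cases far) auto
    have "ennreal q * J + far \<le> J" using near split by (simp add: add_right_mono)
    then have "ennreal (q * j + f) \<le> ennreal j"
      using real f q1 by (simp add: ennreal_mult)
    then have "f \<le> (1 - q) * j" using real by (simp add: algebra_simps)
    also have "\<dots> \<le> (real m * (1 - \<delta>)) * j" using q1 real by (intro mult_right_mono) auto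
    finally show ?thesis using t real f by (simp add: ennreal_leI flip: ennreal_mult)
  qed
  with far have "ennreal (R powr - p * (a * (b - (2 * r) ^ d))) \<le> ennreal (real m * (1 - \<delta>)) * J"
    by (rule order_trans)
  then show ?thesis unfolding J by (simp add: p_def r_def d_def s_def)
qed

section \<open>Dyadic cubes\<close>

text \<open>The half-open cube with corner \<open>2 powi k * z\<close> and side \<open>2 powi k\<close>. With floors, membership is a
  system of equations between integers, and nestedness reduces to integer division.\<close>

definition dyadic_cube :: "int \<Rightarrow> ('n \<Rightarrow> int) \<Rightarrow> (real^'n) set" where
  "dyadic_cube k z = {x. \<forall>i. \<lfloor>x $ i / 2 powi k\<rfloor> = z i}"

lemma mem_dyadic_cube:
  "x \<in> dyadic_cube k z \<longleftrightarrow>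
    (\<forall>i. of_int (z i) * 2 powi k \<le> x $ i \<and> x $ i < of_int (z i) * 2 powi k + 2 powi k)"
proof -
  have "(2::real) powi k > 0" by simp
  then have "\<lfloor>x $ i / 2 powi k\<rfloor> = z i \<longleftrightarrow>
      of_int (z i) * 2 powi k \<le> x $ i \<and> x $ i < of_int (z i) * 2 powi k + 2 powi k" for i
    by (simp add: floor_eq_iff pos_le_divide_eq pos_divide_less_eq distrib_right)
  then show ?thesis by (simp add: dyadic_cube_def)
qed

lemma dyadic_cube_eq_INT:
  "dyadic_cube k z = (\<Inter>i. (\<lambda>x. x $ i) -` {of_int (z i) * 2 powi k ..< of_int (z i) * 2 powi k + 2 powi k})"
  by (auto simp: mem_dyadic_cube)

lemma borel_dyadic_cube [measurable]: "dyadic_cube k (z :: 'n::finite \<Rightarrow> int) \<in> sets borel"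
proof -
  have "(\<lambda>x::real^'n. x $ i) -` {a..<b} \<in> sets borel" for i and a b :: real
    using measurable_sets_borel[of "\<lambda>x::real^'n. x $ i" borel "{a..<b}"]
    by (simp add: borel_measurable_continuous_onI continuous_on_component continuous_on_id)
  then show ?thesis unfolding dyadic_cube_eq_INT by (intro sets.finite_INT) auto
qed

lemma convex_dyadic_cube: "convex (dyadic_cube k (z :: 'n::finite \<Rightarrow> int))"
  unfolding dyadic_cube_eq_INT
proof (rule convex_INT)
  fix i
  show "convex ((\<lambda>x::real^'n. x $ i) -` {a..<b})" for a b :: real
    by (rule convex_linear_vimage[OF bounded_linear.linear[OF bounded_linear_vec_nth]])
      (rule convex_real_interval)
qed

lemma emeasure_dyadic_cube:
  "emeasure lborel (dyadic_cube k (z :: 'n::finite \<Rightarrow> int)) = ennreal ((2 powi k) ^ CARD('n))"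
proof -
  define a b :: "real^'n" where "a = (\<chi> i. of_int (z i) * 2 powi k)"
    and "b = (\<chi> i. of_int (z i) * 2 powi k + 2 powi k)"
  have ab: "a \<bullet> u \<le> b \<bullet> u" if "u \<in> Basis" for u
    using that by (auto simp: Basis_vec_def inner_axis a_def b_def)
  have "(\<Prod>u\<in>Basis. (b - a) \<bullet> u) = (\<Prod>u\<in>(Basis :: (real^'n) set). 2 powi k)"
    by (rule prod.cong) (auto simp: Basis_vec_def inner_axis a_def b_def)
  then have vol: "(\<Prod>u\<in>Basis. (b - a) \<bullet> u) = (2 powi k) ^ CARD('n)" by simp
  have "emeasure lborel (box a b) \<le> emeasure lborel (dyadic_cube k z)"
    by (rule emeasure_mono) (auto simp: mem_dyadic_cube mem_box_cart a_def b_def less_imp_le)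
  moreover have "emeasure lborel (dyadic_cube k z) \<le> emeasure lborel (cbox a b)"
    by (rule emeasure_mono) (auto simp: mem_dyadic_cube mem_box_cart a_def b_def less_imp_le)
  ultimately show ?thesis
    using emeasure_lborel_box[of a b] emeasure_lborel_cbox[of a b] ab vol by simp
qed

lemma norm_diff_le_dyadic_cube:
  assumes "x \<in> dyadic_cube k (z :: 'n::finite \<Rightarrow> int)" "y \<in> dyadic_cube k z"
  shows "norm (y - x) \<le> real CARD('n) * 2 powi k"
proof -
  have "\<bar>(y - x) $ i\<bar> \<le> 2 powi k" for i
    using assms[unfolded mem_dyadic_cube, rule_format, of i] by auto
  then have "(\<Sum>i\<in>UNIV. \<bar>(y - x) $ i\<bar>) \<le> (\<Sum>i\<in>(UNIV :: 'n set). 2 powi k)"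
    by (intro sum_mono) auto
  then show ?thesis using norm_le_l1_cart[of "y - x"] by simp
qed

lemma dyadic_cube_cover: "\<exists>z. x \<in> dyadic_cube k z"
proof
  show "x \<in> dyadic_cube k (\<lambda>i. \<lfloor>x $ i / 2 powi k\<rfloor>)" by (simp add: dyadic_cube_def)
qed

lemma floor_coarser_dyadic:
  fixes t :: real
  assumes "k \<le> k'"
  shows "\<lfloor>t / 2 powi k'\<rfloor> = \<lfloor>t / 2 powi k\<rfloor> div 2 ^ nat (k' - k)"
proof -
  have "(2::real) powi k' = 2 powi k * 2 powi (k' - k)"
    by (subst power_int_add[symmetric]) auto
  also have "(2::real) powi (k' - k) = real_of_int (2 ^ nat (k' - k))"
    using assms by (simp add: power_int_def)
  finally have "t / 2 powi k' = t / 2 powi k / real_of_int (2 ^ nat (k' - k))"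
    by (simp add: divide_divide_eq_left)
  then have "\<lfloor>t / 2 powi k'\<rfloor> = \<lfloor>t / 2 powi k / real_of_int (2 ^ nat (k' - k))\<rfloor>" by (rule arg_cong)
  also have "\<dots> = \<lfloor>t / 2 powi k\<rfloor> div 2 ^ nat (k' - k)" by (rule floor_divide_real_eq_div) simp
  finally show ?thesis .
qed

lemma dyadic_cube_nested:
  assumes "k \<le> k'" "x \<in> dyadic_cube k z" "x \<in> dyadic_cube k' z'"
  shows "dyadic_cube k z \<subseteq> dyadic_cube k' z'"
  using assms(2,3) unfolding dyadic_cube_def floor_coarser_dyadic[OF assms(1)] by auto

definition dyadic_cubes :: "(real^'n) set set" where
  "dyadic_cubes = (\<Union>k. range (dyadic_cube k))"

lemma countable_dyadic_cubes: "countable (dyadic_cubes :: (real^'n::finite) set set)"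
  unfolding dyadic_cubes_def by (intro countable_UN countable_image countableI_type)

lemma dyadic_cube_small:
  fixes x :: "real^'n::finite"
  assumes "open T" "x \<in> T"
  obtains Q where "Q \<in> dyadic_cubes" "x \<in> Q" "Q \<subseteq> T"
proof -
  obtain e where e: "e > 0" "ball x e \<subseteq> T" using assms openE by blast
  obtain N where N: "(1/2) ^ N < e / real CARD('n)"
    using real_arch_pow_inv[of "e / real CARD('n)" "1/2"] e by auto
  obtain z where z: "x \<in> dyadic_cube (- int N) z" using dyadic_cube_cover by blast
  have "dyadic_cube (- int N) z \<subseteq> ball x e"
  proof
    fix y assume "y \<in> dyadic_cube (- int N) z"
    then have "norm (y - x) \<le> real CARD('n) * 2 powi (- int N)"
      by (rule norm_diff_le_dyadic_cube[OF z])
    also have "\<dots> = real CARD('n) * (1/2) ^ N"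
      by (simp only: power_int_minus power_int_of_nat power_one_over inverse_eq_divide)
    also have "\<dots> < e" using N by (simp add: field_simps)
    finally show "y \<in> ball x e" by (simp add: dist_norm norm_minus_commute)
  qed
  moreover have "dyadic_cube (- int N) z \<in> dyadic_cubes" unfolding dyadic_cubes_def by blast
  ultimately show ?thesis using that z e(2) by blast
qed

definition maximal_members :: "'a set set \<Rightarrow> 'a set set" where
  "maximal_members G = {Q \<in> G. \<forall>Q'\<in>G. Q \<subseteq> Q' \<longrightarrow> Q' = Q}"

lemma disjoint_maximal_dyadic_cubes:
  assumes "G \<subseteq> dyadic_cubes"
  shows "disjoint (maximal_members G)"
proof (rule disjointI)
  fix P Q assume P: "P \<in> maximal_members G" and Q: "Q \<in> maximal_members G" and "P \<noteq> Q"
  obtain k z where Pk: "P = dyadic_cube k z"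
    using P assms by (auto simp: maximal_members_def dyadic_cubes_def)
  obtain k' z' where Qk: "Q = dyadic_cube k' z'"
    using Q assms by (auto simp: maximal_members_def dyadic_cubes_def)
  show "P \<inter> Q = {}"
  proof (rule ccontr)
    assume "P \<inter> Q \<noteq> {}"
    then obtain x where x: "x \<in> dyadic_cube k z" "x \<in> dyadic_cube k' z'" using Pk Qk by auto
    have "P \<subseteq> Q \<or> Q \<subseteq> P"
      using dyadic_cube_nested[OF _ x] dyadic_cube_nested[OF _ x(2,1)] Pk Qk
      by (cases "k \<le> k'") auto
    then show False using P Q \<open>P \<noteq> Q\<close> by (auto simp: maximal_members_def)
  qed
qed

text \<open>A volume bound limits the side length from above, so the ascending chain of dyadic cubes through
  a given point has a last member in \<open>G\<close>.\<close>

lemma Union_maximal_dyadic_cubes: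
  fixes G :: "(real^'n::finite) set set"
  assumes G: "G \<subseteq> dyadic_cubes" and V: "\<And>Q. Q \<in> G \<Longrightarrow> emeasure lborel Q \<le> ennreal V"
  shows "\<Union>(maximal_members G) = \<Union>G"
proof
  show "\<Union>(maximal_members G) \<subseteq> \<Union>G" by (auto simp: maximal_members_def)
  show "\<Union>G \<subseteq> \<Union>(maximal_members G)"
  proof
    fix x assume "x \<in> \<Union>G"
    then obtain k z where kz: "dyadic_cube k z \<in> G" "x \<in> dyadic_cube k z"
      using G by (fastforce simp: dyadic_cubes_def)
    define P where "P = (\<lambda>(j, u). k \<le> j \<and> dyadic_cube j u \<in> G \<and> x \<in> dyadic_cube j u)"
    \<comment> \<open>Since \<open>2 powi j\<close> is at most the volume once \<open>j \<ge> 0\<close>, a crude linear bound on the level suffices.\<close>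
    have bound: "j \<le> int (nat \<lceil>V\<rceil>)" if "dyadic_cube j u \<in> G" for j u
    proof (cases "j \<ge> 0")
      case True
      define N where "N = nat j"
      have "ennreal ((2 powi j) ^ CARD('n)) \<le> ennreal V"
        using V[OF that] by (simp add: emeasure_dyadic_cube)
      moreover have pos: "0 < ((2::real) powi j) ^ CARD('n)" by simp
      ultimately have le: "(2 powi j) ^ CARD('n) \<le> V"
        by (metis ennreal_le_iff2 not_le)
      have "real N \<le> 2 ^ N" by (simp add: less_imp_le of_nat_less_two_power)
      also have "\<dots> = 2 powi j" using True by (simp add: N_def power_int_def)
      also have "\<dots> \<le> (2 powi j) ^ CARD('n)"
        using True by (intro self_le_power) (auto simp: one_le_power_int)
      finally have "real N \<le> V" using le by simp
      then show ?thesis using True unfolding N_def by linarith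
    qed linarith
    obtain j u where ju: "P (j, u)" and max: "\<And>j' u'. P (j', u') \<Longrightarrow> nat (j' - k) \<le> nat (j - k)"
    proof -
      have "P (k, z)" using kz by (simp add: P_def)
      moreover have "\<forall>p. P p \<longrightarrow> nat (fst p - k) < Suc (nat (int (nat \<lceil>V\<rceil>) - k))"
        using bound by (auto simp: P_def less_Suc_eq_le intro!: nat_mono)
      ultimately have "\<exists>p. P p \<and> (\<forall>p'. P p' \<longrightarrow> nat (fst p' - k) \<le> nat (fst p - k))"
        by (rule ex_has_greatest_nat)
      then obtain j u where "P (j, u)" "\<forall>p'. P p' \<longrightarrow> nat (fst p' - k) \<le> nat (fst (j, u) - k)"
        by (metis prod.collapse)
      then show ?thesis by (intro that[of j u]) (auto simp only: fst_conv)
    qed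
    have "Q' = dyadic_cube j u" if Q': "Q' \<in> G" "dyadic_cube j u \<subseteq> Q'" for Q'
    proof -
      obtain j' u' where Q'_eq: "Q' = dyadic_cube j' u'" using Q' G by (auto simp: dyadic_cubes_def)
      have x: "x \<in> dyadic_cube j u" "x \<in> dyadic_cube j' u'" using ju Q' Q'_eq by (auto simp: P_def)
      have "j' \<le> j"
        using max[of j' u'] ju Q' Q'_eq x by (cases "k \<le> j'") (auto simp: P_def)
      then show ?thesis using dyadic_cube_nested[OF _ x(2,1)] Q' Q'_eq by auto
    qed
    then show "x \<in> \<Union>(maximal_members G)"
      using ju by (auto simp: maximal_members_def P_def)
  qed
qed

section \<open>Covering a set by half-dense dyadic cubes\<close>

lemma emeasure_Int_Union_countable:
  assumes F: "countable F" "disjoint F" and "\<And>Q. Q \<in> F \<Longrightarrow> S \<inter> Q \<in> sets M"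
  shows "emeasure M (S \<inter> \<Union>F) = (\<integral>\<^sup>+ Q. emeasure M (S \<inter> Q) \<partial>count_space F)"
proof -
  have "emeasure M (\<Union>Q\<in>F. S \<inter> Q) = (\<integral>\<^sup>+ Q. emeasure M (S \<inter> Q) \<partial>count_space F)"
    using assms by (intro emeasure_UN_countable) (auto simp: disjoint_family_on_def disjoint_def)
  moreover have "(\<Union>Q\<in>F. S \<inter> Q) = S \<inter> \<Union>F" by auto
  ultimately show ?thesis by simp
qed

text \<open>A weak dyadic form of the Lebesgue density theorem. Let \<open>N\<close> be the exceptional part of \<open>E\<close>
  and \<open>T \<supseteq> N\<close> open and only slightly larger in volume. The maximal dyadic cubes that lie in
  \<open>T\<close> and meet \<open>N\<close> cover \<open>N\<close>, and \<open>E\<close> has density at most \<open>\<epsilon>\<close> in each of them; hence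
  \<open>|N| \<le> \<epsilon> |T|\<close>, and so \<open>|N| \<le> \<epsilon> |N|\<close>.\<close>

lemma AE_in_dense_dyadic_cube:
  fixes E :: "(real^'n::finite) set"
  assumes E [measurable]: "E \<in> sets borel" and fin: "emeasure lborel E < \<infinity>" and \<epsilon>: "0 < \<epsilon>" "\<epsilon> < 1"
  shows "AE x in lborel. x \<in> E \<longrightarrow>
    x \<in> \<Union>{Q \<in> dyadic_cubes. ennreal \<epsilon> * emeasure lborel Q \<le> emeasure lborel (E \<inter> Q)}"
proof -
  define G where "G = {Q \<in> dyadic_cubes. ennreal \<epsilon> * emeasure lborel Q \<le> emeasure lborel (E \<inter> Q)}"
  have cubes_borel: "Q \<in> sets borel" if "Q \<in> dyadic_cubes" for Q :: "(real^'n) set"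
    using that by (auto simp: dyadic_cubes_def)
  have "\<Union>G \<in> sets borel"
    using countable_subset[OF _ countable_dyadic_cubes, of G] cubes_borel
    by (intro sets.countable_Union) (auto simp: G_def)
  define N where "N = E - \<Union>G"
  have N [measurable]: "N \<in> sets borel" using \<open>\<Union>G \<in> sets borel\<close> by (simp add: N_def)
  have "emeasure lborel N \<le> emeasure lborel E" by (rule emeasure_mono) (auto simp: N_def)
  then obtain \<nu> where \<nu>: "emeasure lborel N = ennreal \<nu>" "\<nu> \<ge> 0"
    using fin by (cases "emeasure lborel N") (auto simp: top_unique)
  have "\<nu> \<le> \<epsilon> * \<nu> + e" if e: "e > 0" for e
  proof -
    obtain T where T: "open T" "N \<subseteq> T" "emeasure lborel (T - N) < ennreal e"
      using outer_regular_lborel[of N e] N e by auto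
    have T_borel [measurable]: "T \<in> sets borel" using T by simp
    have "emeasure lborel T = emeasure lborel N + emeasure lborel (T - N)"
      using T by (subst plus_emeasure) (auto simp: Un_absorb1)
    also have "\<dots> \<le> ennreal (\<nu> + e)"
      using \<nu> T e by (simp add: ennreal_plus add_mono less_imp_le)
    finally have Tm: "emeasure lborel T \<le> ennreal (\<nu> + e)" .
    define H where "H = {Q \<in> dyadic_cubes. Q \<subseteq> T \<and> Q \<inter> N \<noteq> {}}"
    define F where "F = maximal_members H"
    have HV: "emeasure lborel Q \<le> ennreal (\<nu> + e)" if "Q \<in> H" for Q
      using that emeasure_mono[of Q T lborel] Tm by (auto simp: H_def intro: order_trans)
    have FH: "F \<subseteq> H" by (auto simp: F_def maximal_members_def)
    have F: "countable F" "disjoint F" "\<Union>F = \<Union>H"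
      using countable_subset[OF _ countable_dyadic_cubes, of F] FH
        disjoint_maximal_dyadic_cubes[of H] Union_maximal_dyadic_cubes[of H, OF _ HV]
      by (auto simp: F_def H_def)
    have F_borel: "Q \<in> sets borel" if "Q \<in> F" for Q
      using that FH cubes_borel by (auto simp: H_def)
    have "N \<subseteq> \<Union>H"
    proof
      fix x assume "x \<in> N"
      then obtain Q where "Q \<in> dyadic_cubes" "x \<in> Q" "Q \<subseteq> T"
        using T dyadic_cube_small[of T x] by blast
      then show "x \<in> \<Union>H" using \<open>x \<in> N\<close> by (auto simp: H_def)
    qed
    then have "emeasure lborel N = emeasure lborel (N \<inter> \<Union>F)" by (simp add: F Int_absorb2)
    also have "\<dots> = (\<integral>\<^sup>+ Q. emeasure lborel (N \<inter> Q) \<partial>count_space F)"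
      using F F_borel by (intro emeasure_Int_Union_countable) auto
    also have "\<dots> \<le> (\<integral>\<^sup>+ Q. ennreal \<epsilon> * emeasure lborel (T \<inter> Q) \<partial>count_space F)"
    proof (rule nn_integral_mono)
      fix Q assume "Q \<in> space (count_space F)"
      then have Q: "Q \<in> F" "Q \<in> H" using FH by auto
      then have "Q \<notin> G" by (auto simp: H_def N_def)
      then have "emeasure lborel (E \<inter> Q) \<le> ennreal \<epsilon> * emeasure lborel Q"
        using Q by (auto simp: G_def H_def)
      moreover have "emeasure lborel (N \<inter> Q) \<le> emeasure lborel (E \<inter> Q)"
        using F_borel[OF Q(1)] by (intro emeasure_mono) (auto simp: N_def)
      moreover have "T \<inter> Q = Q" using Q by (auto simp: H_def)
      ultimately show "emeasure lborel (N \<inter> Q) \<le> ennreal \<epsilon> * emeasure lborel (T \<inter> Q)" by simp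
    qed
    also have "\<dots> = ennreal \<epsilon> * emeasure lborel (T \<inter> \<Union>F)"
      using F F_borel by (subst emeasure_Int_Union_countable) (auto simp: nn_integral_cmult)
    also have "\<dots> \<le> ennreal \<epsilon> * ennreal (\<nu> + e)"
      by (intro mult_left_mono order_trans[OF emeasure_mono Tm]) auto
    finally have "\<nu> \<le> \<epsilon> * (\<nu> + e)"
      using \<nu> \<epsilon> e by (simp add: ennreal_mult[symmetric] del: ennreal_plus)
    also have "\<dots> \<le> \<epsilon> * \<nu> + e" using mult_right_mono[of \<epsilon> 1 e] \<epsilon> e unfolding distrib_left by linarith
    finally show ?thesis .
  qed
  then have "\<nu> \<le> \<epsilon> * \<nu>" by (rule field_le_epsilon)
  then have "(1 - \<epsilon>) * \<nu> \<le> 0" by (simp add: left_diff_distrib)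
  then have "\<nu> = 0" using \<epsilon> \<nu> by (simp add: mult_le_0_iff)
  then have "N \<in> null_sets lborel" using \<nu> by auto
  then show ?thesis unfolding G_def[symmetric]
    by (rule AE_I') (auto simp: N_def)
qed

text \<open>A stopping-time decomposition in the manner of Calderon and Zygmund, with the cubes chosen from
  above: the parent \<open>P\<close> of a maximal cube \<open>Q\<close> of density at least \<open>2 ^ -(n+1)\<close> is not dense,
  whence \<open>|E \<inter> Q| \<le> |E \<inter> P| \<le> 2 ^ -(n+1) |P| = |Q| / 2\<close>.\<close>

lemma half_dense_dyadic_decomposition:
  fixes E :: "(real^'n::finite) set"
  assumes E [measurable]: "E \<in> sets borel" and fin: "emeasure lborel E < \<infinity>"
  obtains F where "F \<subseteq> dyadic_cubes" "disjoint F" "AE x in lborel. x \<in> E \<longrightarrow> x \<in> \<Union>F"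
    "\<And>Q. Q \<in> F \<Longrightarrow> emeasure lborel Q \<le> 2 ^ (CARD('n) + 1) * emeasure lborel (E \<inter> Q)"
    "\<And>Q. Q \<in> F \<Longrightarrow> 2 * emeasure lborel (E \<inter> Q) \<le> emeasure lborel Q"
proof -
  define \<epsilon> :: real where "\<epsilon> = 1 / 2 ^ (CARD('n) + 1)"
  have "(1::real) < 2 ^ (CARD('n) + 1)" by (rule one_less_power) simp_all
  then have \<epsilon>: "0 < \<epsilon>" "\<epsilon> < 1"
    by (simp_all only: \<epsilon>_def divide_less_eq_1_pos zero_less_power zero_less_numeral zero_less_divide_1_iff)
  define G where "G = {Q \<in> dyadic_cubes. ennreal \<epsilon> * emeasure lborel Q \<le> emeasure lborel (E \<inter> Q)}"
  have scale: "ennreal \<epsilon> * c \<le> d \<longleftrightarrow> c \<le> 2 ^ (CARD('n) + 1) * d" for c d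
  proof -
    have inv: "2 ^ (CARD('n) + 1) * ennreal \<epsilon> = 1"
    proof -
      have "(2::ennreal) ^ (CARD('n) + 1) = ennreal (2 ^ (CARD('n) + 1))"
        by (subst ennreal_power[symmetric]) simp_all
      then have "2 ^ (CARD('n) + 1) * ennreal \<epsilon> = ennreal (2 ^ (CARD('n) + 1) * \<epsilon>)"
        using \<epsilon> by (simp only: ennreal_mult[symmetric] less_imp_le zero_le_power zero_le_numeral)
      then show ?thesis by (simp add: \<epsilon>_def)
    qed
    show ?thesis
    proof
      assume "ennreal \<epsilon> * c \<le> d"
      then have "2 ^ (CARD('n) + 1) * (ennreal \<epsilon> * c) \<le> 2 ^ (CARD('n) + 1) * d"
        by (rule mult_left_mono) simp
      then show "c \<le> 2 ^ (CARD('n) + 1) * d" by (simp only: inv mult.assoc[symmetric] mult_1_left)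
    next
      assume "c \<le> 2 ^ (CARD('n) + 1) * d"
      then have "ennreal \<epsilon> * c \<le> ennreal \<epsilon> * (2 ^ (CARD('n) + 1) * d)"
        by (rule mult_left_mono) simp
      also have "\<dots> = 2 ^ (CARD('n) + 1) * ennreal \<epsilon> * d" by (simp only: mult_ac)
      finally show "ennreal \<epsilon> * c \<le> d" by (simp only: inv mult_1_left)
    qed
  qed
  obtain e where e: "emeasure lborel E = ennreal e" "e \<ge> 0"
    using fin by (cases "emeasure lborel E") auto
  have V: "emeasure lborel Q \<le> ennreal (2 ^ (CARD('n) + 1) * e)" if "Q \<in> G" for Q
  proof -
    have "emeasure lborel Q \<le> 2 ^ (CARD('n) + 1) * emeasure lborel (E \<inter> Q)"
      using that scale by (auto simp: G_def)
    also have "\<dots> \<le> 2 ^ (CARD('n) + 1) * ennreal e"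
      unfolding e(1)[symmetric] by (intro mult_left_mono emeasure_mono) auto
    also have "\<dots> = ennreal (2 ^ (CARD('n) + 1) * e)"
      using e by (simp add: ennreal_mult flip: ennreal_power)
    finally show ?thesis .
  qed
  show ?thesis
  proof (rule that[of "maximal_members G"])
    show "maximal_members G \<subseteq> dyadic_cubes" by (auto simp: maximal_members_def G_def)
    show "disjoint (maximal_members G)" by (rule disjoint_maximal_dyadic_cubes) (auto simp: G_def)
    have "\<Union>(maximal_members G) = \<Union>G"
      by (rule Union_maximal_dyadic_cubes[OF _ V]) (auto simp: G_def)
    then show "AE x in lborel. x \<in> E \<longrightarrow> x \<in> \<Union>(maximal_members G)"
      using AE_in_dense_dyadic_cube[OF E fin \<epsilon>] by (simp only: G_def)
  next
    fix Q assume Q: "Q \<in> maximal_members G"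
    then show "emeasure lborel Q \<le> 2 ^ (CARD('n) + 1) * emeasure lborel (E \<inter> Q)"
      using scale by (auto simp: maximal_members_def G_def)
    obtain k z where Qk: "Q = dyadic_cube k z"
      using Q by (auto simp: maximal_members_def G_def dyadic_cubes_def)
    define l :: real where "l = (2 powi k) ^ CARD('n)"
    have l: "l > 0" by (simp add: l_def)
    have "(\<chi> i. of_int (z i) * 2 powi k) \<in> Q" by (auto simp: Qk mem_dyadic_cube)
    moreover obtain z' where "(\<chi> i. of_int (z i) * 2 powi k) \<in> dyadic_cube (k + 1) z'"
      using dyadic_cube_cover by blast
    ultimately have sub: "Q \<subseteq> dyadic_cube (k + 1) z'"
      unfolding Qk by (intro dyadic_cube_nested) auto
    define P where "P = dyadic_cube (k + 1) z'"
    have mQ: "emeasure lborel Q = ennreal l"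
      by (simp add: Qk l_def emeasure_dyadic_cube)
    have mP: "emeasure lborel P = ennreal (2 ^ CARD('n) * l)"
      by (simp add: P_def l_def emeasure_dyadic_cube power_int_add power_mult_distrib mult.commute)
    have "(1::real) < 2 ^ CARD('n)" by simp
    then have "l < 2 ^ CARD('n) * l" using l by simp
    then have "ennreal l < ennreal (2 ^ CARD('n) * l)" using l by (intro ennreal_lessI) auto
    then have "P \<noteq> Q" unfolding mQ[symmetric] mP[symmetric] by blast
    then have "P \<notin> G" using Q sub by (auto simp: maximal_members_def P_def)
    then have "emeasure lborel (E \<inter> P) \<le> ennreal \<epsilon> * emeasure lborel P"
      by (auto simp: G_def P_def dyadic_cubes_def)
    also have "\<dots> = ennreal (l / 2)"
    proof -
      have "\<epsilon> * (2 ^ CARD('n) * l) = l / 2" by (simp add: \<epsilon>_def)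
      then show ?thesis using l \<epsilon> by (simp add: mP flip: ennreal_mult)
    qed
    finally have "emeasure lborel (E \<inter> P) \<le> ennreal (l / 2)" .
    moreover have "emeasure lborel (E \<inter> Q) \<le> emeasure lborel (E \<inter> P)"
      using sub by (intro emeasure_mono) (auto simp: P_def)
    ultimately have "2 * emeasure lborel (E \<inter> Q) \<le> 2 * ennreal (l / 2)"
      by (intro mult_left_mono) auto
    also have "\<dots> = emeasure lborel Q"
    proof -
      have "ennreal (2 * (l / 2)) = 2 * ennreal (l / 2)" using l by (subst ennreal_mult) auto
      then show ?thesis by (simp add: mQ)
    qed
    finally show "2 * emeasure lborel (E \<inter> Q) \<le> emeasure lborel Q" .
  qed
qed

section \<open>The isoperimetric inequality on half-dense cubes\<close>

lemma cube_dyadic_cube: "cube (dyadic_cube k (z :: 'n::finite \<Rightarrow> int))"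
  unfolding cube_def
proof (intro exI conjI)
  show "(2::real) powi k > 0" by simp
  show "dyadic_cube k z = {x. \<forall>i. x $ i \<in>
      {of_int (z i) * 2 powi k ..< of_int (z i) * 2 powi k + 2 powi k}}"
    by (auto simp: mem_dyadic_cube)
qed auto

text \<open>The factor \<open>n + 3\<close> is the number \<open>m\<close> of halvings in \<open>fractional_perimeter_lower_bound\<close>, the
  power of \<open>n\<close> comes from the diameter bound \<open>n l\<close> of a cube of side \<open>l\<close>, and \<open>2 ^ (n + 3)\<close>
  from the lower bounds \<open>2 ^ -(n+1) l ^ n\<close> for \<open>|A|\<close> and \<open>l ^ n / 4\<close> for \<open>|B| - (2 r) ^ n\<close>.\<close>

definition local_constant :: "nat \<Rightarrow> real" where
  "local_constant n = real (n + 3) * real n ^ (n + 1) * 2 ^ (n + 3)"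

text \<open>The general bound is applied to \<open>A = E \<inter> Q\<close> and \<open>B = Q - E\<close> with \<open>R = n l\<close>. The choice
  \<open>m = n + 3\<close> makes \<open>2 R / 2 ^ m \<le> l / 4\<close>, because \<open>n \<le> 2 ^ n\<close>, so the loss
  \<open>(2 R / 2 ^ m) ^ n\<close> is at most half of the volume of \<open>B\<close>.\<close>

lemma half_dense_cube_estimate:
  fixes E :: "(real^'n::finite) set" and \<delta> :: real and k :: int and z :: "'n \<Rightarrow> int"
  defines "Q \<equiv> dyadic_cube k z"
  assumes E [measurable]: "E \<in> sets borel" and \<delta>: "0 \<le> \<delta>" "\<delta> < 1"
    and dense: "emeasure lborel Q \<le> 2 ^ (CARD('n) + 1) * emeasure lborel (E \<inter> Q)"
    and half: "2 * emeasure lborel (E \<inter> Q) \<le> emeasure lborel Q"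
  shows "ennreal ((2 powi k) powr (real CARD('n) - \<delta>)) \<le> ennreal (local_constant CARD('n) * (1 - \<delta>)) *
    (\<integral>\<^sup>+ x\<in>E \<inter> Q. (\<integral>\<^sup>+ y\<in>-E. ennreal (1 / norm (x - y) powr (real CARD('n) + \<delta>)) \<partial>lborel) \<partial>lborel)"
proof -
  define n where "n = CARD('n)"
  define l :: real where "l = 2 powi k"
  define R where "R = real n * l"
  define p where "p = real n + \<delta>"
  have n: "n \<ge> 1" unfolding n_def by (simp add: Suc_leI)
  have l: "l > 0" by (simp add: l_def)
  have Q [measurable]: "Q \<in> sets borel" by (simp add: Q_def)
  have mQ: "emeasure lborel Q = ennreal (l ^ n)" by (simp add: Q_def l_def n_def emeasure_dyadic_cube)
  have "emeasure lborel (E \<inter> Q) \<le> emeasure lborel Q" by (rule emeasure_mono) auto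
  then obtain a where a: "emeasure lborel (E \<inter> Q) = ennreal a" "a \<ge> 0"
    using mQ by (cases "emeasure lborel (E \<inter> Q)") (auto simp: top_unique)
  have "2 ^ (CARD('n) + 1) * ennreal a = ennreal (2 ^ (n + 1) * a)"
    unfolding n_def using a by (subst ennreal_mult) (simp_all add: ennreal_power[symmetric] del: power_Suc)
  then have a1: "l ^ n \<le> 2 ^ (n + 1) * a" using dense a by (simp add: mQ)
  have "2 * ennreal a = ennreal (2 * a)" using a by (subst ennreal_mult) auto
  then have a2: "2 * a \<le> l ^ n" using half a l by (simp add: mQ)
  have "emeasure lborel (Q - E \<inter> Q) = emeasure lborel Q - emeasure lborel (E \<inter> Q)"
    by (rule emeasure_Diff) (auto simp: a)
  moreover have "Q - E \<inter> Q = Q - E" by auto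
  ultimately have b: "emeasure lborel (Q - E) = ennreal (l ^ n - a)"
    using a by (simp add: mQ ennreal_minus)
  have "convex (E \<inter> Q \<union> (Q - E))"
  proof -
    have "E \<inter> Q \<union> (Q - E) = Q" by auto
    then show ?thesis by (simp add: Q_def convex_dyadic_cube)
  qed
  then have "ennreal (R powr - p * (a * (l ^ n - a - (2 * R / 2 ^ (n + 3)) ^ n)))
     \<le> ennreal (real (n + 3) * (1 - \<delta>)) *
        (\<integral>\<^sup>+ x\<in>E \<inter> Q. (\<integral>\<^sup>+ y\<in>Q - E. ennreal (1 / norm (x - y) powr p) \<partial>lborel) \<partial>lborel)"
    using fractional_perimeter_lower_bound[of "E \<inter> Q" "Q - E" R a "l ^ n - a" \<delta> "n + 3"] a b a2 \<delta> l n
      norm_diff_le_dyadic_cube[where k = k and z = z]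
    by (auto simp: R_def l_def Q_def n_def p_def)
  also have "\<dots> \<le> ennreal (real (n + 3) * (1 - \<delta>)) *
        (\<integral>\<^sup>+ x\<in>E \<inter> Q. (\<integral>\<^sup>+ y\<in>-E. ennreal (1 / norm (x - y) powr p) \<partial>lborel) \<partial>lborel)"
    by (intro mult_left_mono nn_integral_mono mult_right_mono) (auto split: split_indicator)
  finally have main: "ennreal (R powr - p * (a * (l ^ n - a - (2 * R / 2 ^ (n + 3)) ^ n))) \<le> \<dots>" .
  define C where "C = real n ^ (n + 1) * 2 ^ (n + 3)"
  have C: "C > 0" using n by (simp add: C_def)
  have "l powr (real n - \<delta>) \<le> C * (R powr - p * (a * (l ^ n - a - (2 * R / 2 ^ (n + 3)) ^ n)))"
  proof -
    have "real n \<le> 2 ^ n" by (simp add: less_imp_le of_nat_less_two_power)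
    then have "real n * l \<le> 2 ^ n * l" using l by (intro mult_right_mono) auto
    then have "2 * R / 2 ^ (n + 3) \<le> l / 4" by (simp add: R_def power_add field_simps)
    then have "(2 * R / 2 ^ (n + 3)) ^ n \<le> (l / 4) ^ n"
      using l by (intro power_mono) (auto simp: R_def)
    also have "\<dots> = l ^ n / 4 ^ n" by (rule power_divide)
    also have "\<dots> \<le> l ^ n / 4"
      using l n self_le_power[of "4::real" n] by (intro divide_left_mono) auto
    finally have "l ^ n / 4 \<le> l ^ n - a - (2 * R / 2 ^ (n + 3)) ^ n" using a2 by simp
    moreover have "l ^ n / 2 ^ (n + 1) \<le> a" using a1 by (simp add: field_simps)
    ultimately have gap: "l ^ n / 2 ^ (n + 1) * (l ^ n / 4) \<le> a * (l ^ n - a - (2 * R / 2 ^ (n + 3)) ^ n)"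
      using l a by (intro mult_mono) auto
    have "l powr - p / real n ^ (n + 1) \<le> R powr - p"
    proof -
      have "real n powr p \<le> real n powr real (n + 1)"
        using n \<delta> by (intro powr_mono) (auto simp: p_def)
      also have "\<dots> = real n ^ (n + 1)" using n by (intro powr_realpow) auto
      finally have "l powr - p / real n ^ (n + 1) \<le> l powr - p / real n powr p"
        using n by (intro divide_left_mono) auto
      also have "\<dots> = R powr - p"
        using n l by (simp add: R_def powr_mult powr_minus divide_inverse)
      finally show ?thesis .
    qed
    from mult_mono[OF this gap] have "l powr - p / real n ^ (n + 1) * (l ^ n / 2 ^ (n + 1) * (l ^ n / 4))
        \<le> R powr - p * (a * (l ^ n - a - (2 * R / 2 ^ (n + 3)) ^ n))"
      using l by simp
    then have "C * (l powr - p / real n ^ (n + 1) * (l ^ n / 2 ^ (n + 1) * (l ^ n / 4)))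
        \<le> C * (R powr - p * (a * (l ^ n - a - (2 * R / 2 ^ (n + 3)) ^ n)))"
      using C by (intro mult_left_mono) auto
    moreover have "C * (l powr - p / real n ^ (n + 1) * (l ^ n / 2 ^ (n + 1) * (l ^ n / 4)))
        = l powr - p * (l ^ n * l ^ n)"
      using n by (simp add: C_def power_add field_simps)
    moreover have "l powr - p * (l ^ n * l ^ n) = l powr (real n - \<delta>)"
      using l by (simp add: p_def flip: powr_realpow powr_add)
    ultimately show ?thesis by simp
  qed
  then have "ennreal (l powr (real n - \<delta>)) \<le> ennreal C * ennreal (R powr - p * (a * (l ^ n - a - (2 * R / 2 ^ (n + 3)) ^ n)))"
    using C by (subst ennreal_mult'[symmetric]) (auto intro: ennreal_leI)
  also have "\<dots> \<le> ennreal C * (ennreal (real (n + 3) * (1 - \<delta>)) *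
        (\<integral>\<^sup>+ x\<in>E \<inter> Q. (\<integral>\<^sup>+ y\<in>-E. ennreal (1 / norm (x - y) powr p) \<partial>lborel) \<partial>lborel))"
    using main by (rule mult_left_mono) simp
  also have "\<dots> = ennreal (C * (real (n + 3) * (1 - \<delta>))) *
        (\<integral>\<^sup>+ x\<in>E \<inter> Q. (\<integral>\<^sup>+ y\<in>-E. ennreal (1 / norm (x - y) powr p) \<partial>lborel) \<partial>lborel)"
    using C by (subst ennreal_mult') (auto simp: mult.assoc)
  also have "C * (real (n + 3) * (1 - \<delta>)) = local_constant n * (1 - \<delta>)"
    by (simp add: C_def local_constant_def)
  finally show ?thesis by (simp only: l_def p_def n_def)
qed

text \<open>As \<open>\<theta> - 1 \<le> 0\<close> and no summand exceeds the sum \<open>A\<close>, each \<open>\<alpha> i powr \<theta>\<close> is at least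
  \<open>A powr (\<theta> - 1) * \<alpha> i\<close>.\<close>

lemma powr_sum_le_sum_powr:
  assumes \<theta>: "0 < \<theta>" "\<theta> \<le> 1" and A: "A \<ge> 0" and \<alpha>: "\<And>i. i \<in> I \<Longrightarrow> \<alpha> i \<ge> 0"
    and sum: "(\<integral>\<^sup>+ i. ennreal (\<alpha> i) \<partial>count_space I) = ennreal A"
  shows "ennreal (A powr \<theta>) \<le> (\<integral>\<^sup>+ i. ennreal (\<alpha> i powr \<theta>) \<partial>count_space I)"
proof (cases "A = 0")
  case False
  with A have A: "A > 0" by simp
  have le: "\<alpha> i \<le> A" if "i \<in> I" for i
    using nn_integral_ge_point[OF that, of "\<lambda>i. ennreal (\<alpha> i)"] A by (simp add: sum)
  have "A powr \<theta> = A powr (\<theta> - 1) * A" using A by (simp add: powr_diff)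
  then have "ennreal (A powr \<theta>) = ennreal (A powr (\<theta> - 1)) * (\<integral>\<^sup>+ i. ennreal (\<alpha> i) \<partial>count_space I)"
    using A by (simp add: sum ennreal_mult)
  also have "\<dots> = (\<integral>\<^sup>+ i. ennreal (A powr (\<theta> - 1)) * ennreal (\<alpha> i) \<partial>count_space I)"
    by (simp add: nn_integral_cmult)
  also have "\<dots> \<le> (\<integral>\<^sup>+ i. ennreal (\<alpha> i powr \<theta>) \<partial>count_space I)"
  proof (rule nn_integral_mono)
    fix i assume "i \<in> space (count_space I)"
    then have i: "i \<in> I" by simp
    have "A powr (\<theta> - 1) * \<alpha> i \<le> \<alpha> i powr \<theta>"
    proof (cases "\<alpha> i = 0")
      case False
      then have pos: "\<alpha> i > 0" using \<alpha>[OF i] by simp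
      then have "A powr (\<theta> - 1) \<le> \<alpha> i powr (\<theta> - 1)"
        using \<theta> le[OF i] by (intro powr_mono2') auto
      then have "A powr (\<theta> - 1) * \<alpha> i \<le> \<alpha> i powr (\<theta> - 1) * \<alpha> i"
        using pos by (intro mult_right_mono) auto
      then show ?thesis using pos by (simp add: powr_diff)
    qed simp
    then show "ennreal (A powr (\<theta> - 1)) * ennreal (\<alpha> i) \<le> ennreal (\<alpha> i powr \<theta>)"
      using \<alpha>[OF i] by (simp add: ennreal_leI flip: ennreal_mult)
  qed
  finally show ?thesis .
qed simp

lemma ennreal_powr_mono:
  assumes "ennreal a \<le> X" "0 \<le> a" "0 \<le> p"
  shows "ennreal (a powr p) \<le> ennreal_powr X p"
proof (cases X)
  case (real r)
  then have "a \<le> r" using assms by simp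
  then show ?thesis using real assms by (auto simp: ennreal_powr_def intro!: ennreal_leI powr_mono2)
qed (simp add: ennreal_powr_def)

section \<open>The weighted inequality\<close>

text \<open>Only local integrability of \<open>w\<close> is given, so countable additivity is obtained from the measure
  with density \<open>w\<close> restricted to a set \<open>K\<close> on which \<open>w\<close> is integrable.\<close>

lemma emeasure_weighted_eq_weight_measure:
  fixes w :: "real^'n::finite \<Rightarrow> real"
  assumes int: "set_integrable lebesgue K w" and X: "X \<subseteq> K" "X \<in> sets lebesgue"
  shows "emeasure (density lebesgue (\<lambda>x. ennreal (indicat_real K x *\<^sub>R w x))) X = weight_measure w X"
    and "weight_measure w X < \<infinity>"
proof -
  have m: "(\<lambda>x. indicat_real K x *\<^sub>R w x) \<in> borel_measurable lebesgue"
    using int unfolding set_integrable_def by (rule borel_measurable_integrable)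
  have eq: "ennreal (indicat_real K x *\<^sub>R w x) * indicator X x = ennreal (w x) * indicator X x" for x
    using X by (auto split: split_indicator)
  show *: "emeasure (density lebesgue (\<lambda>x. ennreal (indicat_real K x *\<^sub>R w x))) X = weight_measure w X"
    unfolding weight_measure_def
    by (subst emeasure_density) (use m X eq in \<open>auto\<close>)
  have "weight_measure w X \<le> (\<integral>\<^sup>+ x. norm (indicat_real K x *\<^sub>R w x) \<partial>lebesgue)"
    unfolding weight_measure_def
    using X by (intro nn_integral_mono) (auto split: split_indicator intro: ennreal_leI)
  also have "\<dots> < \<infinity>"
    using int unfolding set_integrable_def integrable_iff_bounded by blast
  finally show "weight_measure w X < \<infinity>" .
qed

lemma weight_measure_le_maximal_function:
  fixes w :: "real^'n::finite \<Rightarrow> real"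
  assumes "x \<in> dyadic_cube k z"
    and "weight_measure w (E \<inter> dyadic_cube k z) = ennreal \<alpha>" "\<alpha> \<ge> 0"
  shows "ennreal (\<alpha> / (2 powi k) ^ CARD('n)) \<le> maximal_function w x"
proof -
  let ?Q = "dyadic_cube k z"
  have "ennreal \<alpha> \<le> (\<integral>\<^sup>+ y\<in>?Q. ennreal \<bar>w y\<bar> \<partial>lebesgue)"
    unfolding assms(2)[symmetric] weight_measure_def
    by (intro nn_integral_mono) (auto split: split_indicator intro: ennreal_leI)
  then have "ennreal \<alpha> / emeasure lebesgue ?Q \<le> (\<integral>\<^sup>+ y\<in>?Q. ennreal \<bar>w y\<bar> \<partial>lebesgue) / emeasure lebesgue ?Q"
    by (rule divide_right_mono_ennreal)
  also have "\<dots> \<le> maximal_function w x"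
    unfolding maximal_function_def using assms(1) cube_dyadic_cube by (intro SUP_upper) auto
  finally show ?thesis
    using assms(3) by (simp add: emeasure_dyadic_cube divide_ennreal)
qed

text \<open>For Borel \<open>E\<close> the inner integral is a Borel function of \<open>x\<close>, so that sums over the cubes can be
  interchanged with the integral. The maximal function is bounded below pointwise on each cube \<open>Q\<close>
  by the constant \<open>w(E \<inter> Q) / |Q|\<close>, which keeps the functions being summed measurable.\<close>

lemma weighted_isoperimetric_borel:
  fixes E :: "(real^'n::finite) set" and \<delta> :: real
  assumes E [measurable]: "E \<in> sets borel" and "bounded E" and \<delta>: "0 \<le> \<delta>" "\<delta> < 1"
    and w: "locally_integrable w"
  shows "ennreal_powr (weight_measure w E) ((real CARD('n) - \<delta>) / real CARD('n))
        \<le> ennreal (local_constant CARD('n) * (1 - \<delta>)) *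
           (\<integral>\<^sup>+ x\<in>E.
               (\<integral>\<^sup>+ y\<in>-E. ennreal (1 / norm (x - y) powr (real CARD('n) + \<delta>)) \<partial>lborel)
               * ennreal_powr (maximal_function w x) ((real CARD('n) - \<delta>) / real CARD('n))
             \<partial>lborel)"
proof -
  define n where "n = CARD('n)"
  define \<theta> where "\<theta> = (real n - \<delta>) / real n"
  define c where "c = local_constant n * (1 - \<delta>)"
  define W where "W x = (\<integral>\<^sup>+ y\<in>-E. ennreal (1 / norm (x - y) powr (real n + \<delta>)) \<partial>lborel)" for x
  define M where "M x = ennreal_powr (maximal_function w x) \<theta>" for x
  have n: "real n \<ge> 1" unfolding n_def by (simp add: Suc_leI)
  have \<theta>: "0 < \<theta>" "\<theta> \<le> 1" using n \<delta> by (auto simp: \<theta>_def)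
  have c: "c \<ge> 0" using \<delta> by (simp add: c_def local_constant_def)
  have [measurable]: "W \<in> borel_measurable borel" unfolding W_def by measurable
  obtain r where r: "E \<subseteq> cball 0 r" using \<open>bounded E\<close> by (auto simp: bounded_iff subset_iff)
  have int: "set_integrable lebesgue (cball 0 r) w"
    using w by (simp add: locally_integrable_def)
  define \<mu> where "\<mu> = density lebesgue (\<lambda>x. ennreal (indicat_real (cball 0 r) x *\<^sub>R w x))"
  have leb: "X \<in> sets lebesgue" if "X \<in> sets borel" for X :: "(real^'n) set"
    using that by (simp add: sets_completionI_sets)
  have \<mu>: "emeasure \<mu> (E \<inter> X) = weight_measure w (E \<inter> X)" "weight_measure w (E \<inter> X) < \<infinity>" if "X \<in> sets borel" for X
    using emeasure_weighted_eq_weight_measure[OF int, of "E \<inter> X"] that r E leb unfolding \<mu>_def by auto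
  have fin: "emeasure lborel E < \<infinity>"
    using \<open>bounded E\<close> by (rule emeasure_bounded_finite)
  obtain F where F: "F \<subseteq> dyadic_cubes" "disjoint F" "AE x in lborel. x \<in> E \<longrightarrow> x \<in> \<Union>F"
    "\<And>Q. Q \<in> F \<Longrightarrow> emeasure lborel Q \<le> 2 ^ (CARD('n) + 1) * emeasure lborel (E \<inter> Q)"
    "\<And>Q. Q \<in> F \<Longrightarrow> 2 * emeasure lborel (E \<inter> Q) \<le> emeasure lborel Q"
    using half_dense_dyadic_decomposition[OF E fin] by blast
  have countF: "countable F" using F(1) countable_dyadic_cubes countable_subset by blast
  have F_borel: "Q \<in> sets borel" if "Q \<in> F" for Q using that F(1) by (auto simp: dyadic_cubes_def)
  define \<alpha> where "\<alpha> Q = enn2real (weight_measure w (E \<inter> Q))" for Q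
  have \<alpha>: "weight_measure w (E \<inter> Q) = ennreal (\<alpha> Q)" "\<alpha> Q \<ge> 0" if "Q \<in> sets borel" for Q
    using \<mu>(2)[OF that] by (auto simp: \<alpha>_def)
  have E\<alpha>: "weight_measure w E = ennreal (\<alpha> UNIV)" using \<alpha>(1)[of UNIV] by simp
  have "\<Union>F \<in> sets borel" using countF F_borel by (intro sets.countable_Union) auto
  have "weight_measure w E = weight_measure w (E \<inter> \<Union>F)"
    unfolding weight_measure_def nn_integral_completion
    by (rule nn_integral_cong_AE) (use F(3) in \<open>auto split: split_indicator\<close>)
  also have "\<dots> = emeasure \<mu> (E \<inter> \<Union>F)" using \<mu>(1) \<open>\<Union>F \<in> sets borel\<close> by simp
  also have "\<dots> = (\<integral>\<^sup>+ Q. emeasure \<mu> (E \<inter> Q) \<partial>count_space F)"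
    using countF F(2) F_borel leb by (intro emeasure_Int_Union_countable) (auto simp: \<mu>_def)
  also have "\<dots> = (\<integral>\<^sup>+ Q. ennreal (\<alpha> Q) \<partial>count_space F)"
    using \<mu>(1) \<alpha>(1) F_borel by (intro nn_integral_cong) auto
  finally have "(\<integral>\<^sup>+ Q. ennreal (\<alpha> Q) \<partial>count_space F) = ennreal (\<alpha> UNIV)" using E\<alpha> by simp
  then have "ennreal (\<alpha> UNIV powr \<theta>) \<le> (\<integral>\<^sup>+ Q. ennreal (\<alpha> Q powr \<theta>) \<partial>count_space F)"
    using \<theta> \<alpha>(2) F_borel by (intro powr_sum_le_sum_powr) auto
  also have "\<dots> \<le> (\<integral>\<^sup>+ Q. ennreal c * (\<integral>\<^sup>+ x. ennreal ((\<alpha> Q / measure lborel Q) powr \<theta>) * (W x * indicator (E \<inter> Q) x) \<partial>lborel) \<partial>count_space F)"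
  proof (rule nn_integral_mono)
    fix Q assume "Q \<in> space (count_space F)"
    then have Q: "Q \<in> F" by simp
    have [measurable]: "Q \<in> sets borel" using F_borel Q .
    obtain k z where Qk: "Q = dyadic_cube k z" using Q F(1) by (auto simp: dyadic_cubes_def)
    define l :: real where "l = 2 powi k"
    have l: "l > 0" by (simp add: l_def)
    have mQ: "measure lborel Q = l ^ n"
      by (simp add: measure_def Qk emeasure_dyadic_cube l_def n_def)
    have est: "ennreal (l powr (real n - \<delta>)) \<le> ennreal c * (\<integral>\<^sup>+ x\<in>E \<inter> Q. W x \<partial>lborel)"
      using half_dense_cube_estimate[OF E \<delta>, of k z] F(4,5)[OF Q]
      by (simp only: Qk[symmetric] c_def W_def l_def n_def)
    have "(l ^ n) powr \<theta> = l powr (real n - \<delta>)"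
      using l n by (simp add: \<theta>_def powr_powr flip: powr_realpow)
    moreover have "\<alpha> Q powr \<theta> = (\<alpha> Q / l ^ n) powr \<theta> * (l ^ n) powr \<theta>"
      using l \<alpha>(2)[of Q] by (simp add: powr_mult[symmetric])
    ultimately have "ennreal (\<alpha> Q powr \<theta>) = ennreal ((\<alpha> Q / l ^ n) powr \<theta>) * ennreal (l powr (real n - \<delta>))"
      by (simp add: ennreal_mult)
    also have "\<dots> \<le> ennreal ((\<alpha> Q / l ^ n) powr \<theta>) * (ennreal c * (\<integral>\<^sup>+ x\<in>E \<inter> Q. W x \<partial>lborel))"
      using est by (rule mult_left_mono) simp
    also have "\<dots> = ennreal c * (\<integral>\<^sup>+ x. ennreal ((\<alpha> Q / l ^ n) powr \<theta>) * (W x * indicator (E \<inter> Q) x) \<partial>lborel)"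
      by (subst nn_integral_cmult) (auto simp: mult_ac)
    finally show "ennreal (\<alpha> Q powr \<theta>) \<le> ennreal c * (\<integral>\<^sup>+ x. ennreal ((\<alpha> Q / measure lborel Q) powr \<theta>) * (W x * indicator (E \<inter> Q) x) \<partial>lborel)"
      by (simp only: mQ)
  qed
  also have "\<dots> = ennreal c * (\<integral>\<^sup>+ x. (\<integral>\<^sup>+ Q. ennreal ((\<alpha> Q / measure lborel Q) powr \<theta>) * (W x * indicator (E \<inter> Q) x) \<partial>count_space F) \<partial>lborel)"
    using F_borel by (subst nn_integral_count_space_nn_integral[OF countF]) (auto simp: nn_integral_cmult)
  also have "\<dots> \<le> ennreal c * (\<integral>\<^sup>+ x\<in>E. W x * M x \<partial>lborel)"
  proof (intro mult_left_mono nn_integral_mono)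
    \<comment> \<open>By disjointness at most one cube contributes at \<open>x\<close>.\<close>
    fix x :: "real^'n"
    have "(\<integral>\<^sup>+ Q. ennreal ((\<alpha> Q / measure lborel Q) powr \<theta>) * (W x * indicator (E \<inter> Q) x) \<partial>count_space F)
        \<le> W x * M x * indicator E x"
    proof (cases "x \<in> E \<inter> \<Union>F")
      case False
      then have "ennreal ((\<alpha> Q / measure lborel Q) powr \<theta>) * (W x * indicator (E \<inter> Q) x) = 0" if "Q \<in> F" for Q
        using that by auto
      then have "(\<integral>\<^sup>+ Q. ennreal ((\<alpha> Q / measure lborel Q) powr \<theta>) * (W x * indicator (E \<inter> Q) x) \<partial>count_space F) = (\<integral>\<^sup>+ Q. 0 \<partial>count_space F)"
        by (intro nn_integral_cong) auto
      then show ?thesis by simp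
    next
      case True
      then obtain P where P: "P \<in> F" "x \<in> P" and "x \<in> E" by auto
      obtain k z where Pk: "P = dyadic_cube k z" using P F(1) by (auto simp: dyadic_cubes_def)
      have "measure lborel P = (2 powi k) ^ CARD('n)"
        by (simp add: measure_def Pk emeasure_dyadic_cube)
      then have "ennreal (\<alpha> P / measure lborel P) \<le> maximal_function w x"
        using weight_measure_le_maximal_function[of x k z w E "\<alpha> P"] P \<alpha>[of P] F_borel by (simp add: Pk)
      then have M: "ennreal ((\<alpha> P / measure lborel P) powr \<theta>) \<le> M x"
        unfolding M_def using \<theta> \<alpha>(2)[OF F_borel[OF P(1)]] by (intro ennreal_powr_mono) auto
      have "(\<integral>\<^sup>+ Q. ennreal ((\<alpha> Q / measure lborel Q) powr \<theta>) * (W x * indicator (E \<inter> Q) x) \<partial>count_space F)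
          \<le> (\<integral>\<^sup>+ Q. (W x * M x) * indicator {P} Q \<partial>count_space F)"
      proof (rule nn_integral_mono)
        fix Q assume "Q \<in> space (count_space F)"
        then have eq: "Q = P" if "x \<in> Q"
          using that P F(2) by (auto simp: disjoint_def)
        show "ennreal ((\<alpha> Q / measure lborel Q) powr \<theta>) * (W x * indicator (E \<inter> Q) x) \<le> (W x * M x) * indicator {P} Q"
        proof (cases "x \<in> Q")
          case True
          then show ?thesis
            using eq mult_right_mono[OF M, of "W x"] P \<open>x \<in> E\<close> by (simp add: mult.commute)
        qed simp
      qed
      also have "\<dots> = W x * M x"
        using P by (subst nn_integral_cmult_indicator) auto
      finally show ?thesis using \<open>x \<in> E\<close> by simp
    qed
    then show "(\<integral>\<^sup>+ Q. ennreal ((\<alpha> Q / measure lborel Q) powr \<theta>) * (W x * indicator (E \<inter> Q) x) \<partial>count_space F)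
        \<le> W x * M x * indicator E x" .
  qed simp
  finally have "ennreal (\<alpha> UNIV powr \<theta>) \<le> ennreal c * (\<integral>\<^sup>+ x\<in>E. W x * M x \<partial>lborel)" .
  moreover have "ennreal_powr (weight_measure w E) \<theta> = ennreal (\<alpha> UNIV powr \<theta>)"
    using \<alpha>(2)[of UNIV] by (simp add: E\<alpha> ennreal_powr_def)
  ultimately show ?thesis by (simp only: \<theta>_def c_def W_def M_def n_def)
qed

theorem corollary2p12:
  "\<exists>c::real. c > 0 \<and>
     (\<forall>(w :: real^'n \<Rightarrow> real) (\<delta>::real) (E :: (real^'n) set).
        weight w \<longrightarrow> \<not> integrable lebesgue w \<longrightarrow>
        1/2 \<le> \<delta> \<longrightarrow> \<delta> < 1 \<longrightarrow>
        bounded E \<longrightarrow> E \<in> sets lebesgue \<longrightarrow>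
        ennreal_powr (weight_measure w E) ((real CARD('n) - \<delta>) / real CARD('n))
        \<le> ennreal (c * (1 - \<delta>)) *
           ((\<integral>\<^sup>+ x\<in>E.
               (\<integral>\<^sup>+ y\<in>-E. ennreal (1 / norm (x - y) powr (real CARD('n) + \<delta>)) \<partial>lebesgue)
               * ennreal_powr (maximal_function w x) ((real CARD('n) - \<delta>) / real CARD('n))
             \<partial>lebesgue)
          + (\<integral>\<^sup>+ x\<in>-E.
               (\<integral>\<^sup>+ y\<in>E. ennreal (1 / norm (x - y) powr (real CARD('n) + \<delta>)) \<partial>lebesgue)
               * ennreal_powr (maximal_function w x) ((real CARD('n) - \<delta>) / real CARD('n))
             \<partial>lebesgue)))"
proof (intro exI conjI allI impI)
  show "local_constant CARD('n) > 0" by (simp add: local_constant_def)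
  fix w :: "real^'n \<Rightarrow> real" and \<delta> :: real and E :: "(real^'n) set"
  assume w: "weight w" and \<delta>: "1/2 \<le> \<delta>" "\<delta> < 1" and E: "bounded E" "E \<in> sets lebesgue"
  define \<theta> where "\<theta> = (real CARD('n) - \<delta>) / real CARD('n)"
  define k where "k x y = ennreal (1 / norm (x - y) powr (real CARD('n) + \<delta>))" for x y :: "real^'n"
  define M where "M x = ennreal_powr (maximal_function w x) \<theta>" for x
  \<comment> \<open>Changing \<open>E\<close> on a null set alters none of the integrals, so a Borel part of \<open>E\<close> will do.\<close>
  obtain E0 N N' where E0: "E = E0 \<union> N" "N \<subseteq> N'" "N' \<in> null_sets lborel" "E0 \<in> sets lborel"
    using E(2) by (rule sets_completionE)
  have AE: "AE x in lborel. x \<in> E \<longleftrightarrow> x \<in> E0"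
    using AE_not_in[OF E0(3)] by eventually_elim (use E0 in auto)
  have inner: "(\<integral>\<^sup>+ y\<in>-E0. k x y \<partial>lborel) = (\<integral>\<^sup>+ y\<in>-E. k x y \<partial>lborel)" for x
    by (rule nn_integral_cong_AE) (use AE in \<open>eventually_elim, auto split: split_indicator\<close>)
  have outer: "(\<integral>\<^sup>+ x\<in>E0. (\<integral>\<^sup>+ y\<in>-E. k x y \<partial>lborel) * M x \<partial>lborel)
      = (\<integral>\<^sup>+ x\<in>E. (\<integral>\<^sup>+ y\<in>-E. k x y \<partial>lborel) * M x \<partial>lborel)"
    by (rule nn_integral_cong_AE) (use AE in \<open>eventually_elim, auto split: split_indicator\<close>)
  have "weight_measure w E = weight_measure w E0"
    unfolding weight_measure_def nn_integral_completion
    by (rule nn_integral_cong_AE) (use AE in \<open>eventually_elim, auto split: split_indicator\<close>)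
  moreover have "bounded E0" using E(1) by (rule bounded_subset) (simp add: E0)
  ultimately have "ennreal_powr (weight_measure w E) \<theta> \<le> ennreal (local_constant CARD('n) * (1 - \<delta>)) *
      (\<integral>\<^sup>+ x\<in>E0. (\<integral>\<^sup>+ y\<in>-E0. k x y \<partial>lborel) * M x \<partial>lborel)"
    using weighted_isoperimetric_borel[of E0 \<delta> w] E0(4) \<delta> w
    by (simp add: weight_def \<theta>_def k_def M_def)
  also have "\<dots> = ennreal (local_constant CARD('n) * (1 - \<delta>)) *
      (\<integral>\<^sup>+ x\<in>E. (\<integral>\<^sup>+ y\<in>-E. k x y \<partial>lborel) * M x \<partial>lborel)"
    by (simp only: inner outer)
  also have "\<dots> \<le> ennreal (local_constant CARD('n) * (1 - \<delta>)) *
      ((\<integral>\<^sup>+ x\<in>E. (\<integral>\<^sup>+ y\<in>-E. k x y \<partial>lborel) * M x \<partial>lborel)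
        + (\<integral>\<^sup>+ x\<in>-E. (\<integral>\<^sup>+ y\<in>E. k x y \<partial>lborel) * M x \<partial>lborel))"
    by (intro mult_left_mono) auto
  finally show "ennreal_powr (weight_measure w E) ((real CARD('n) - \<delta>) / real CARD('n))
        \<le> ennreal (local_constant CARD('n) * (1 - \<delta>)) *
           ((\<integral>\<^sup>+ x\<in>E.
               (\<integral>\<^sup>+ y\<in>-E. ennreal (1 / norm (x - y) powr (real CARD('n) + \<delta>)) \<partial>lebesgue)
               * ennreal_powr (maximal_function w x) ((real CARD('n) - \<delta>) / real CARD('n))
             \<partial>lebesgue)
          + (\<integral>\<^sup>+ x\<in>-E.
               (\<integral>\<^sup>+ y\<in>E. ennreal (1 / norm (x - y) powr (real CARD('n) + \<delta>)) \<partial>lebesgue)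
               * ennreal_powr (maximal_function w x) ((real CARD('n) - \<delta>) / real CARD('n))
             \<partial>lebesgue))"
    unfolding nn_integral_completion by (simp only: k_def M_def \<theta>_def)
qed

end
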